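(* Every non-consecutive Latin square of order $5$ is built by cycling a cyclable permutation. That is, if $L$ is a $5\times 5$ non-consecutive Latin square, then the first row of $L$ is a cyclable non-consecutive permutation of $1,2,3,4,5$, and either every subsequent row of $L$ is the left cyclic shift by $1$ of the previous row, or every subsequent row of $L$ is the right cyclic shift by $1$ of the previous row.
   Context: A Latin square of order $n$ is an $n\times n$ table filled with the integers $1,\dots,n$ so that each integer appears exactly once in each row and in each column. Two integers are consecutive if they differ by exactly $1$. A non-consecutive Latin square is a Latin square in which no two orthogonally adjacent cells (horizontal or vertical neighbors) contain consecutive integers. A permutation of $1,\dots,n$, written as a word, is non-consecutive if no two neighboring entries are consecutive integers. A non-consecutive permutation is cyclable if its first and last entries are also not consecutive integers (so that all its cyclic shifts are again non-consecutive). Cycling a cyclable permutation means taking it as the first row and shifting it cyclically by $1$ from each row to the next, always to the left or always to the right. *)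

theory Defs
  imports "HOL-Combinatorics.Multiset_Permutations"
begin

text \<open>
  An \<open>n\<close> by \<open>n\<close> table is the list of its rows, from top to bottom, each row being read
  from left to right; rows and columns are indexed from \<open>0\<close>, entries range over \<open>1, \<dots>, n\<close>.
\<close>

definition consecutive :: "int \<Rightarrow> int \<Rightarrow> bool" where
  "consecutive a b \<longleftrightarrow> \<bar>a - b\<bar> = 1"

definition latin_square :: "nat \<Rightarrow> int list list \<Rightarrow> bool" where
  "latin_square n L \<longleftrightarrow>
     length L = n \<and> (\<forall>i<n. length (L ! i) = n) \<and>
     (\<forall>i<n. \<forall>j<n. L ! i ! j \<in> {1..int n}) \<and>
     (\<forall>i<n. \<forall>k\<in>{1..int n}. \<exists>!j. j < n \<and> L ! i ! j = k) \<and>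
     (\<forall>j<n. \<forall>k\<in>{1..int n}. \<exists>!i. i < n \<and> L ! i ! j = k)"

definition nonconsecutive_latin_square :: "nat \<Rightarrow> int list list \<Rightarrow> bool" where
  "nonconsecutive_latin_square n L \<longleftrightarrow>
     latin_square n L \<and>
     (\<forall>i j. i < n \<and> Suc j < n \<longrightarrow> \<not> consecutive (L ! i ! j) (L ! i ! Suc j)) \<and>
     (\<forall>i j. Suc i < n \<and> j < n \<longrightarrow> \<not> consecutive (L ! i ! j) (L ! Suc i ! j))"

definition nonconsecutive_permutation :: "nat \<Rightarrow> int list \<Rightarrow> bool" where
  "nonconsecutive_permutation n xs \<longleftrightarrow>
     xs \<in> permutations_of_set {1..int n} \<and> successively (\<lambda>a b. \<not> consecutive a b) xs"

definition cyclable :: "nat \<Rightarrow> int list \<Rightarrow> bool" where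
  "cyclable n xs \<longleftrightarrow>
     nonconsecutive_permutation n xs \<and> \<not> consecutive (hd xs) (last xs)"

text \<open>
  The left cyclic shift by \<open>1\<close> is the library's \<^const>\<open>rotate1\<close>, which moves the first entry
  to the end; the following is the shift in the opposite direction.
\<close>

definition right_rotate1 :: "'a list \<Rightarrow> 'a list" where
  "right_rotate1 xs = (if xs = [] then [] else last xs # butlast xs)"

end

theory Submission
  imports Defs
begin

text \<open>
  Only 14 permutations of \<open>1, \<dots>, 5\<close> are non-consecutive.  Stacking them row by row, while
  keeping the columns non-consecutive and free of repetitions, leaves just 20 squares,
  each of which is seen to be cyclic.
\<close>

definition nonconsecutive_rows :: "int list list" where
  "nonconsecutive_rows =
    [[1,3,5,2,4], [1,4,2,5,3], [2,4,1,3,5], [2,4,1,5,3], [2,5,3,1,4], [3,1,4,2,5], [3,1,5,2,4],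
     [3,5,1,4,2], [3,5,2,4,1], [4,1,3,5,2], [4,2,5,1,3], [4,2,5,3,1], [5,2,4,1,3], [5,3,1,4,2]]"

text \<open>Evaluation filters all 120 permutations. Writing the interval as the set of an explicit
  list turns the abstract set of permutations into a computable list; comparing sets makes the order
  of enumeration irrelevant.\<close>

lemma nonconsecutive_permutation_5_iff:
  "nonconsecutive_permutation 5 xs \<longleftrightarrow> xs \<in> set nonconsecutive_rows"
proof -
  have "{1..int 5} = set [1,2,3,4,5]"
    by auto
  then have "permutations_of_set {1..int 5} = set (permutations_of_set_list [1,2,3,4,5])"
    by (simp only: permutations_of_list) simp
  moreover have "set (filter (successively (\<lambda>a b. \<not> consecutive a b))
      (permutations_of_set_list [1,2,3,4,5])) = set nonconsecutive_rows"
    by code_simp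
  ultimately show ?thesis
    unfolding nonconsecutive_permutation_def by (metis (no_types, lifting) mem_Collect_eq set_filter)
qed

text \<open>The test for placing \<open>r\<close> below the rows \<open>rs\<close>. A repetition in
  a column can involve any earlier row, a vertical adjacency only the last one; the case
  \<open>rs = []\<close> shields the unspecified \<open>last []\<close>.\<close>

definition fits :: "int list list \<Rightarrow> int list \<Rightarrow> bool" where
  "fits rs r \<longleftrightarrow> list_all (\<lambda>s. list_all2 (\<noteq>) s r) rs \<and>
     (rs = [] \<or> list_all2 (\<lambda>a b. \<not> consecutive a b) (last rs) r)"

text \<open>A level-by-level search with pruning: each new row is tested against the partial stack,
  so bad stacks are dropped early instead of listing all 14^5 choices of five rows.\<close>

primrec stacks :: "('a list \<Rightarrow> 'a \<Rightarrow> bool) \<Rightarrow> 'a list \<Rightarrow> nat \<Rightarrow> 'a list list" where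
  "stacks P R 0 = [[]]"
| "stacks P R (Suc k) = concat (map (\<lambda>rs. map (\<lambda>r. rs @ [r]) (filter (P rs) R)) (stacks P R k))"

text \<open>Completeness of the search: every prefix of \<open>L\<close> survives, since
  \<open>take (Suc k) L\<close> is \<open>take k L\<close> extended by \<open>L ! k\<close>, which
  passes the test.\<close>

lemma take_in_stacks:
  assumes "\<And>i. i < length L \<Longrightarrow> L ! i \<in> set R"
    and "\<And>i. i < length L \<Longrightarrow> P (take i L) (L ! i)"
    and "k \<le> length L"
  shows "take k L \<in> set (stacks P R k)"
  using assms(3)
proof (induction k)
  case (Suc k)
  then show ?case
    using assms(1,2)[of k] by (auto simp: take_Suc_conv_app_nth)
qed simp

text \<open>The desired conclusion in executable form, without the permutation part of
  \<open>cyclable\<close>, which the row lemmas supply.\<close>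

definition cyclic_square :: "int list list \<Rightarrow> bool" where
  "cyclic_square L \<longleftrightarrow> \<not> consecutive (hd (hd L)) (last (hd L)) \<and>
     (successively (\<lambda>r s. s = rotate1 r) L \<or> successively (\<lambda>r s. s = right_rotate1 r) L)"

text \<open>A finite check: the 20 squares come from the 10 cyclable rows among the 14, each shifted
  in either direction.\<close>

lemma stacks_cyclic: "list_all cyclic_square (stacks fits nonconsecutive_rows 5)"
  by code_simp

text \<open>All \<open>n\<close> values occur among the \<open>n\<close> entries of the row, so
  counting forces the entries to be distinct.\<close>

lemma latin_square_row_permutation:
  assumes "latin_square n L" "i < n"
  shows "L ! i \<in> permutations_of_set {1..int n}"
proof -
  have len: "length (L ! i) = n"
    and ran: "\<forall>j<n. L ! i ! j \<in> {1..int n}"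
    and ex: "\<forall>k\<in>{1..int n}. \<exists>j<n. L ! i ! j = k"
    using assms unfolding latin_square_def by metis+
  have "set (L ! i) = {1..int n}"
    unfolding set_conv_nth using len ran ex by (intro equalityI subsetI) (blast, force)
  moreover from this have "distinct (L ! i)"
    using len by (intro card_distinct) simp
  ultimately show ?thesis
    by (rule permutations_of_setI)
qed

lemma latin_square_column_inj:
  assumes "latin_square n L" "i < n" "i' < n" "j < n" "i \<noteq> i'"
  shows "L ! i ! j \<noteq> L ! i' ! j"
proof -
  have "L ! i ! j \<in> {1..int n}" and "\<forall>k\<in>{1..int n}. \<exists>!i. i < n \<and> L ! i ! j = k"
    using assms(1,2,4) by (simp_all add: latin_square_def)
  then have "\<exists>!i'. i' < n \<and> L ! i' ! j = L ! i ! j"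
    by blast
  then show ?thesis
    using assms(2,3,5) by metis
qed

lemma nonconsecutive_latin_square_row:
  assumes "nonconsecutive_latin_square n L" "i < n"
  shows "nonconsecutive_permutation n (L ! i)"
proof -
  have sq: "latin_square n L"
    and "\<And>j. Suc j < n \<Longrightarrow> \<not> consecutive (L ! i ! j) (L ! i ! Suc j)"
    using assms unfolding nonconsecutive_latin_square_def by blast+
  moreover have "length (L ! i) = n"
    using sq assms(2) by (simp add: latin_square_def)
  ultimately show ?thesis
    using latin_square_row_permutation[OF sq assms(2)]
    unfolding nonconsecutive_permutation_def successively_conv_nth by auto
qed

lemma nonconsecutive_latin_square_fits:
  assumes "nonconsecutive_latin_square n L" "i < n"
  shows "fits (take i L) (L ! i)"
proof -
  have sq: "latin_square n L"
    and nc: "\<And>i j. Suc i < n \<Longrightarrow> j < n \<Longrightarrow> \<not> consecutive (L ! i ! j) (L ! Suc i ! j)"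
    using assms unfolding nonconsecutive_latin_square_def by blast+
  have len: "length L = n" "\<And>i. i < n \<Longrightarrow> length (L ! i) = n"
    using sq by (simp_all add: latin_square_def)
  have "list_all2 (\<noteq>) (L ! k) (L ! i)" if "k < i" for k
    using latin_square_column_inj[OF sq, of k i] len that assms(2)
    by (auto simp: list_all2_conv_all_nth)
  then have "list_all (\<lambda>s. list_all2 (\<noteq>) s (L ! i)) (take i L)"
    by (simp add: list_all_length)
  moreover have "take i L = [] \<or> list_all2 (\<lambda>a b. \<not> consecutive a b) (last (take i L)) (L ! i)"
  \<comment> \<open>The top row has nothing above it; otherwise the last row of the prefix is the
    one directly above row \<open>i\<close>.\<close>
  proof (cases i)
    case (Suc k)
    then have "last (take i L) = L ! k"
      using assms(2) len by (simp add: take_Suc_conv_app_nth)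
    then show ?thesis
      using nc[of k] len Suc assms(2) by (auto simp: list_all2_conv_all_nth)
  qed simp
  ultimately show ?thesis
    unfolding fits_def ..
qed

theorem proposition1:
  fixes L :: "int list list"
  assumes "nonconsecutive_latin_square 5 L"
  shows "cyclable 5 (L ! 0) \<and>
    ((\<forall>i. Suc i < 5 \<longrightarrow> L ! Suc i = rotate1 (L ! i)) \<or>
     (\<forall>i. Suc i < 5 \<longrightarrow> L ! Suc i = right_rotate1 (L ! i)))"
proof -
  have len: "length L = 5"
    using assms by (simp add: nonconsecutive_latin_square_def latin_square_def)
  have row: "nonconsecutive_permutation 5 (L ! i)" if "i < 5" for i
    using nonconsecutive_latin_square_row[OF assms that] .
  have "take 5 L \<in> set (stacks fits nonconsecutive_rows 5)"
    using len row nonconsecutive_latin_square_fits[OF assms]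
    by (intro take_in_stacks) (simp_all add: nonconsecutive_permutation_5_iff)
  \<comment> \<open>Since \<open>L\<close> has five rows, \<open>take 5 L\<close> is
    \<open>L\<close> itself, so the search result applies to it.\<close>
  then have "cyclic_square L"
    using stacks_cyclic len by (simp add: list_all_iff)
  moreover have "hd L = L ! 0"
    using len by (intro hd_conv_nth) auto
  ultimately show ?thesis
    using row[of 0] len
    by (auto simp: cyclic_square_def cyclable_def successively_conv_nth)
qed

end
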